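(* The family of paths with an odd number of vertices is safe-infinite.
   Context: All graphs are finite, simple, undirected and connected (except that induced subgraphs considered below may be disconnected). For a graph $G$ and $S\subset V(G)$, $G[S]$ is the subgraph induced by $S$ and $G-S=G[V(G)\setminus S]$. "Component" means connected component (often identified with its vertex set), and $k(H)$ is the number of components of a graph $H$. A weight function $w$ on $V(G)$ is a map assigning a positive real number to each vertex; $\mathcal{W}(G)$ is the set of all weight functions on $V(G)$. For $X\subset V(G)$, $w(X)=\sum_{v\in X}w(v)$. For disjoint $A,B\subset V(G)$, $E(A,B)$ is the set of edges joining a vertex of $A$ to a vertex of $B$. A non-empty subset $S\subset V(G)$ is a weighted safe set of $(G,w)$ if for every component $C$ of $G[S]$ and every component $D$ of $G-S$, $w(C)\ge w(D)$ whenever $E(C,D)\neq\emptyset$. The weighted safe number $\mathrm{s}(G,w)$ is the minimum of $w(S)$ over all weighted safe sets $S$ of $(G,w)$; a minimum weighted safe set is a weighted safe set $S$ with $w(S)=\mathrm{s}(G,w)$. For a family $\mathcal{G}$ of graphs let $$f(\mathcal{G})=\max_{G\in\mathcal{G},\,w\in\mathcal{W}(G)}\ \min\{k(G[S])\mid S\text{ is a minimum weighted safe set of }(G,w)\},$$ where $f(\mathcal{G})=\infty$ if these values are unbounded. The family $\mathcal{G}$ is safe-finite if $f(\mathcal{G})<\infty$, and safe-infinite if it is not safe-finite. *)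

theory Defs
  imports Complex_Main "HOL-Library.Extended_Nat"
begin

text \<open>Edges are two-element sets of vertices.\<close>

record 'a ugraph =
  verts :: "'a set"
  edges :: "'a set set"

definition simple_graph :: "'a ugraph \<Rightarrow> bool" where
  "simple_graph G \<longleftrightarrow> finite (verts G) \<and> (\<forall>e\<in>edges G. e \<subseteq> verts G \<and> card e = 2)"

definition induced :: "'a ugraph \<Rightarrow> 'a set \<Rightarrow> 'a ugraph" where
  "induced G S = \<lparr>verts = verts G \<inter> S, edges = {e \<in> edges G. e \<subseteq> S}\<rparr>"

definition remove_verts :: "'a ugraph \<Rightarrow> 'a set \<Rightarrow> 'a ugraph" where
  "remove_verts G S = induced G (verts G - S)"

definition adj :: "'a ugraph \<Rightarrow> ('a \<times> 'a) set" where
  "adj G = {(u, v). {u, v} \<in> edges G}"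

definition components :: "'a ugraph \<Rightarrow> 'a set set" where
  "components G = {{v \<in> verts G. (u, v) \<in> (adj G)\<^sup>*} | u. u \<in> verts G}"

definition num_components :: "'a ugraph \<Rightarrow> nat" where
  "num_components G = card (components G)"

definition connected_graph :: "'a ugraph \<Rightarrow> bool" where
  "connected_graph G \<longleftrightarrow> num_components G = 1"

definition edges_between :: "'a ugraph \<Rightarrow> 'a set \<Rightarrow> 'a set \<Rightarrow> 'a set set" where
  "edges_between G A B = {e \<in> edges G. \<exists>a\<in>A. \<exists>b\<in>B. e = {a, b}}"

text \<open>A weight function is represented by a total function; its values outside
  \<open>verts G\<close> are irrelevant to everything below.\<close>

definition weight_functions :: "'a ugraph \<Rightarrow> ('a \<Rightarrow> real) set" where
  "weight_functions G = {w. \<forall>v\<in>verts G. w v > 0}"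

definition weighted_safe_set :: "'a ugraph \<Rightarrow> ('a \<Rightarrow> real) \<Rightarrow> 'a set \<Rightarrow> bool" where
  "weighted_safe_set G w S \<longleftrightarrow>
     S \<noteq> {} \<and> S \<subseteq> verts G \<and>
     (\<forall>C\<in>components (induced G S). \<forall>D\<in>components (remove_verts G S).
        edges_between G C D \<noteq> {} \<longrightarrow> sum w C \<ge> sum w D)"

text \<open>The minima below are over finite sets, which are non-empty for every finite non-empty
  graph, since \<open>verts G\<close> is then itself a weighted safe set.\<close>

definition weighted_safe_number :: "'a ugraph \<Rightarrow> ('a \<Rightarrow> real) \<Rightarrow> real" where
  "weighted_safe_number G w = Min {sum w S | S. weighted_safe_set G w S}"

definition min_weighted_safe_set :: "'a ugraph \<Rightarrow> ('a \<Rightarrow> real) \<Rightarrow> 'a set \<Rightarrow> bool" where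
  "min_weighted_safe_set G w S \<longleftrightarrow>
     weighted_safe_set G w S \<and> sum w S = weighted_safe_number G w"

definition min_safe_components :: "'a ugraph \<Rightarrow> ('a \<Rightarrow> real) \<Rightarrow> nat" where
  "min_safe_components G w =
     Min {num_components (induced G S) | S. min_weighted_safe_set G w S}"

text \<open>The supremum in \<^typ>\<open>enat\<close> is the maximum when the values are bounded, and
  \<open>\<infinity>\<close> otherwise. Families are meant to consist of non-empty connected simple graphs.\<close>

definition safe_f :: "'a ugraph set \<Rightarrow> enat" where
  "safe_f \<G> = (SUP G\<in>\<G>. SUP w\<in>weight_functions G. enat (min_safe_components G w))"

definition safe_finite :: "'a ugraph set \<Rightarrow> bool" where
  "safe_finite \<G> \<longleftrightarrow> safe_f \<G> < \<infinity>"

definition safe_infinite :: "'a ugraph set \<Rightarrow> bool" where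
  "safe_infinite \<G> \<longleftrightarrow> \<not> safe_finite \<G>"

text \<open>The path running through the vertices of a list in the given order.\<close>

definition path_on :: "'a list \<Rightarrow> 'a ugraph" where
  "path_on vs = \<lparr>verts = set vs, edges = {{vs ! i, vs ! Suc i} | i. Suc i < length vs}\<rparr>"

definition is_path_graph :: "'a ugraph \<Rightarrow> bool" where
  "is_path_graph G \<longleftrightarrow> (\<exists>vs. vs \<noteq> [] \<and> distinct vs \<and> G = path_on vs)"

text \<open>Vertices are natural numbers; every finite graph has an isomorphic copy of this kind.\<close>

definition odd_paths :: "nat ugraph set" where
  "odd_paths = {G. is_path_graph G \<and> odd (card (verts G))}"

lemma path_graph_simple: "is_path_graph G \<Longrightarrow> simple_graph G"
  by (force simp: is_path_graph_def path_on_def simple_graph_def card_insert_if nth_eq_iff_index_eq)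

lemma path_graph_connected:
  assumes "is_path_graph G"
  shows "connected_graph G"
proof -
  obtain vs where vs: "vs \<noteq> []" and G: "G = path_on vs"
    using assms by (auto simp: is_path_graph_def)
  have step: "(vs ! i, vs ! Suc i) \<in> adj G" "(vs ! Suc i, vs ! i) \<in> adj G"
    if "Suc i < length vs" for i
    using that by (auto simp: G path_on_def adj_def insert_commute)
  have from0: "(vs ! 0, vs ! i) \<in> (adj G)\<^sup>* \<and> (vs ! i, vs ! 0) \<in> (adj G)\<^sup>*"
    if "i < length vs" for i
    using that
    by (induction i) (auto intro: rtrancl_into_rtrancl converse_rtrancl_into_rtrancl step)
  have all: "(u, v) \<in> (adj G)\<^sup>*" if "u \<in> verts G" "v \<in> verts G" for u v
    using that from0 by (auto simp: G path_on_def in_set_conv_nth intro: rtrancl_trans)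
  have "verts G \<noteq> {}"
    using vs by (simp add: G path_on_def)
  then have "components G = {verts G}"
    using all by (auto simp: components_def)
  then show ?thesis
    by (simp add: connected_graph_def num_components_def)
qed

end

theory Submission
  imports Defs
begin

text \<open>
  For every \<open>k > 0\<close> there are weights on the path \<open>0, 1, \<dots>, 2 * k\<close> for which the set of all odd
  vertices is the only minimum weighted safe set; it has \<open>k\<close> components, so the parameter of the
  family is infinite.

  Group the vertices into \<open>k\<close> pairs \<open>(2 * i, 2 * i + 1)\<close> followed by the single vertex \<open>2 * k\<close>.
  Roughly, the two weights in a pair are equal and they halve from one pair to the next, so that
  the odd vertices carry slightly less than half of the total weight. Let \<open>S\<close> be a safe set that is
  not heavier than the set of odd vertices, and suppose that \<open>S\<close> contains exactly the odd vertices
  among those before \<open>2 * i\<close>. There are three ways to deviate at the pair \<open>(2 * i, 2 * i + 1)\<close>.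

  \<^item> Taking both vertices is too expensive, because \<open>2 * i\<close> outweighs all odd vertices after
    \<open>2 * i + 1\<close> together.

  \<^item> Taking neither leaves a gap that is heavier than its left neighbour \<open>2 * i - 1\<close>.

  \<^item> Taking only \<open>2 * i\<close> leaves a gap that starts at \<open>2 * i + 1\<close>. If the gap is the whole rest of the
    path, then it is heavier than \<open>{2 * i - 1, 2 * i}\<close>. Otherwise another component of \<open>S\<close> follows,
    and it must weigh at least as much as \<open>2 * i + 1\<close>, which again exceeds the budget.

  For \<open>i = 0\<close> there is no left neighbour; there the second case is settled by the budget as well,
  because \<open>S\<close> is non-empty and so a component of \<open>S\<close> follows the gap.
  The locale \<open>forcing_weights\<close> collects the inequalities behind these arguments,
  \<open>cheap_safe_set_alternates\<close> carries out the induction, and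
  \<open>forcing_weights_doubling_weight\<close> provides weights that satisfy all of the inequalities.
\<close>

section \<open>Connected components inside a path\<close>

definition nat_path :: "nat \<Rightarrow> nat ugraph" where
  "nat_path n = path_on [0..<n]"

lemma verts_nat_path: "verts (nat_path n) = {..<n}"
  by (auto simp: nat_path_def path_on_def)

lemma edges_nat_path: "edges (nat_path n) = {{i, Suc i} | i. Suc i < n}"
proof -
  have "[0..<n] ! i = i \<and> [0..<n] ! Suc i = Suc i" if "Suc i < n" for i
    using that by (simp add: nth_upt del: upt_Suc)
  then have "{{[0..<n] ! i, [0..<n] ! Suc i} | i. Suc i < n} = {{i, Suc i} | i. Suc i < n}"
    by (intro Collect_cong ex_cong1) auto
  then show ?thesis
    by (simp add: nat_path_def path_on_def)
qed

lemma adj_induced_nat_path: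
  "(u, v) \<in> adj (induced (nat_path n) S) \<longleftrightarrow>
     u \<in> S \<and> v \<in> S \<and> u < n \<and> v < n \<and> (v = Suc u \<or> u = Suc v)"
  by (auto simp: adj_def induced_def edges_nat_path doubleton_eq_iff)

lemma verts_induced_nat_path:
  "S \<subseteq> {..<n} \<Longrightarrow> verts (induced (nat_path n) S) = S"
  by (auto simp: induced_def verts_nat_path)

lemma remove_verts_nat_path:
  "remove_verts (nat_path n) S = induced (nat_path n) ({..<n} - S)"
  by (simp add: remove_verts_def verts_nat_path)

lemma maximal_interval_component:
  assumes S: "S \<subseteq> {..<n}" and "x \<le> y" and sub: "{x..y} \<subseteq> S"
    and left: "\<And>u. Suc u = x \<Longrightarrow> u \<notin> S" and right: "Suc y \<notin> S"
  shows "{x..y} \<in> components (induced (nat_path n) S)"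
proof -
  let ?A = "adj (induced (nat_path n) S)"
  have reach: "(x, v) \<in> ?A\<^sup>*" if "x \<le> v" "v \<le> y" for v
    using that
  proof (induction v rule: dec_induct)
    case (step v)
    have "(v, Suc v) \<in> ?A"
      using step S sub by (auto simp: adj_induced_nat_path subset_iff)
    then show ?case
      using step by (auto intro: rtrancl_into_rtrancl)
  qed auto
  have closed: "v \<in> {x..y}" if "(x, v) \<in> ?A\<^sup>*" for v
    using that
  proof (induction rule: rtrancl_induct)
    case base
    show ?case using \<open>x \<le> y\<close> by simp
  next
    case (step u v)
    then have *: "v \<in> S" "v = Suc u \<or> u = Suc v" "x \<le> u" "u \<le> y"
      by (auto simp: adj_induced_nat_path)
    show ?case
    proof (rule ccontr)
      assume "v \<notin> {x..y}"
      then have "v = Suc y \<or> Suc v = x"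
        using * by auto
      then show False
        using * left right by auto
    qed
  qed
  have "{x..y} = {v \<in> verts (induced (nat_path n) S). (x, v) \<in> ?A\<^sup>*}"
    using reach closed sub S by (auto simp: verts_induced_nat_path subset_iff)
  moreover have "x \<in> verts (induced (nat_path n) S)"
    using \<open>x \<le> y\<close> sub S by (auto simp: verts_induced_nat_path)
  ultimately show ?thesis
    unfolding components_def by blast
qed

lemma components_without_adjacent_vertices:
  assumes S: "S \<subseteq> {..<n}" and isolated: "\<And>u. u \<in> S \<Longrightarrow> Suc u \<notin> S"
  shows "components (induced (nat_path n) S) = (\<lambda>v. {v}) ` S"
proof -
  have "adj (induced (nat_path n) S) = {}"
    using isolated by (auto simp: adj_induced_nat_path)
  then show ?thesis
    using S by (auto simp: components_def verts_induced_nat_path)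
qed

lemma interval_extends_maximally:
  fixes T :: "nat set"
  assumes "finite T" "v \<in> T"
  obtains z where "v \<le> z" "{v..z} \<subseteq> T" "Suc z \<notin> T"
proof -
  define u where "u = (LEAST u. v \<le> u \<and> u \<notin> T)"
  obtain u0 where "v \<le> u0" "u0 \<notin> T"
    using assms(1) by (meson finite_nat_set_iff_bounded_le not_less_eq_eq nat_le_linear)
  then have u: "v \<le> u \<and> u \<notin> T"
    unfolding u_def by (metis (mono_tags, lifting) LeastI)
  have below: "t \<in> T" if "v \<le> t" "t < u" for t
    using not_less_Least that unfolding u_def by blast
  have "u \<noteq> v"
    using u assms(2) by auto
  then obtain z where z: "u = Suc z" "v \<le> z"
    using u by (cases u) auto
  show thesis
    by (rule that[of z]) (use z u below in auto)
qed

section \<open>Safety inequalities between neighbouring intervals\<close>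

text \<open>Components of a subgraph of a path are maximal intervals, so every maximal interval of \<open>S\<close> has
  to outweigh the maximal interval of the complement that starts right after it.\<close>

lemma safe_set_interval_before_gap:
  assumes safe: "weighted_safe_set (nat_path n) w S"
    and "x \<le> y" "y < z" "z < n"
    and C: "{x..y} \<subseteq> S" "\<And>u. Suc u = x \<Longrightarrow> u \<notin> S"
    and D: "{Suc y..z} \<inter> S = {}" "Suc z < n \<Longrightarrow> Suc z \<in> S"
  shows "sum w {Suc y..z} \<le> sum w {x..y}"
proof -
  have S: "S \<subseteq> {..<n}"
    using safe by (simp add: weighted_safe_set_def verts_nat_path)
  have C': "{x..y} \<in> components (induced (nat_path n) S)"
    by (rule maximal_interval_component) (use assms S in \<open>auto simp: disjoint_iff\<close>)
  have D': "{Suc y..z} \<in> components (remove_verts (nat_path n) S)"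
    unfolding remove_verts_nat_path
    by (rule maximal_interval_component) (use assms S in auto)
  have edge: "{y, Suc y} \<in> edges (nat_path n)"
    using assms(3,4) by (auto simp: edges_nat_path)
  have ends: "y \<in> {x..y}" "Suc y \<in> {Suc y..z}"
    using assms(2,3) by auto
  have "{y, Suc y} \<in> edges_between (nat_path n) {x..y} {Suc y..z}"
    unfolding edges_between_def using edge ends by blast
  with safe C' D' show ?thesis
    by (auto simp: weighted_safe_set_def)
qed

lemma safe_set_interval_after_gap:
  assumes safe: "weighted_safe_set (nat_path n) w S"
    and "x \<le> y" "y < z" "z < n"
    and C: "{Suc y..z} \<subseteq> S" "Suc z \<notin> S"
    and D: "{x..y} \<inter> S = {}" "\<And>u. Suc u = x \<Longrightarrow> u \<in> S"
  shows "sum w {x..y} \<le> sum w {Suc y..z}"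
proof -
  have S: "S \<subseteq> {..<n}"
    using safe by (simp add: weighted_safe_set_def verts_nat_path)
  have C': "{Suc y..z} \<in> components (induced (nat_path n) S)"
    by (rule maximal_interval_component) (use assms S in auto)
  have D': "{x..y} \<in> components (remove_verts (nat_path n) S)"
    unfolding remove_verts_nat_path
    by (rule maximal_interval_component) (use assms S in auto)
  have edge: "{y, Suc y} \<in> edges (nat_path n)"
    using assms(3,4) by (auto simp: edges_nat_path)
  have ends: "y \<in> {x..y}" "Suc y \<in> {Suc y..z}"
    using assms(2,3) by auto
  have "{y, Suc y} \<in> edges_between (nat_path n) {Suc y..z} {x..y}"
    unfolding edges_between_def using edge ends by blast
  with safe C' D' show ?thesis
    by (auto simp: weighted_safe_set_def)
qed

section \<open>Weights that force the alternating set\<close>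

definition odd_below :: "nat \<Rightarrow> nat set" where
  "odd_below k = (\<lambda>j. 2 * j + 1) ` {..<k}"

lemma mem_odd_below: "v \<in> odd_below k \<longleftrightarrow> odd v \<and> v < 2 * k"
  by (auto simp: odd_below_def image_iff elim!: oddE)

lemma finite_odd_below [simp]: "finite (odd_below k)"
  by (simp add: odd_below_def)

lemma card_odd_below: "card (odd_below k) = k"
  by (simp add: odd_below_def card_image inj_on_def)

lemma sum_odd_below: "sum w (odd_below k) = (\<Sum>j<k. w (2 * j + 1))"
  by (simp add: odd_below_def sum.reindex inj_on_def)

text \<open>Each inequality rules out one deviation from the odd vertices. The pair weight
  \<open>w (2 * i + 2) + w (2 * i + 3)\<close> bounds from below any gap that contains this pair, and
  \<open>tail_exceeds\<close> compares the component \<open>{2 * i + 1, 2 * i + 2}\<close> with the gap that fills the rest of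
  the path. Only \<open>exceeds_later\<close> concerns the cost of a set rather than its safety.\<close>

locale forcing_weights =
  fixes k :: nat and w :: "nat \<Rightarrow> real"
  assumes k_pos: "0 < k"
    and pos: "v \<le> 2 * k \<Longrightarrow> 0 < w v"
    and dominates_left: "i < k \<Longrightarrow> w (2 * i) \<le> w (2 * i + 1)"
    and dominates_right: "i < k \<Longrightarrow> w (2 * i + 2) \<le> w (2 * i + 1)"
    and pair_exceeds_previous: "Suc i < k \<Longrightarrow> w (2 * i + 1) < w (2 * i + 2) + w (2 * i + 3)"
    and tail_exceeds: "Suc i < k \<Longrightarrow> w (2 * i + 1) + w (2 * i + 2) < sum w {2 * i + 3..2 * k}"
    and exceeds_later: "i < k \<Longrightarrow> (\<Sum>j\<in>{Suc i..<k}. w (2 * j + 1)) < w (2 * i)"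
begin

abbreviation G :: "nat ugraph" where "G \<equiv> nat_path (Suc (2 * k))"

text \<open>Following the odd vertices up to the pair \<open>(2 * i, 2 * i + 1)\<close> and then paying for both of its
  vertices costs too much, since the additional \<open>2 * i\<close> is not compensated by omitting all later odd
  vertices. The payment need not be for the pair itself: a component that has to dominate a gap
  around \<open>2 * i + 1\<close> is charged in the same way.\<close>

lemma budget_exceeded:
  assumes "i < k"
  shows "sum w (odd_below k) < sum w (odd_below i) + w (2 * i) + w (2 * i + 1)"
proof -
  have "{..<k} = {..<i} \<union> insert i {Suc i..<k}" "{..<i} \<inter> insert i {Suc i..<k} = {}"
    using assms by auto
  then have "sum w (odd_below k) =
      sum w (odd_below i) + w (2 * i + 1) + (\<Sum>j\<in>{Suc i..<k}. w (2 * j + 1))"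
    unfolding sum_odd_below by (simp add: sum.union_disjoint)
  then show ?thesis
    using exceeds_later[OF assms] by simp
qed

lemma odd_below_safe: "weighted_safe_set G w (odd_below k)"
proof -
  let ?S = "odd_below k"
  have S: "?S \<subseteq> {..<Suc (2 * k)}"
    by (auto simp: mem_odd_below)
  have C: "components (induced G ?S) = (\<lambda>v. {v}) ` ?S"
    using S by (intro components_without_adjacent_vertices) (auto simp: mem_odd_below)
  have D: "components (remove_verts G ?S) = (\<lambda>v. {v}) ` ({..<Suc (2 * k)} - ?S)"
    unfolding remove_verts_nat_path
    by (intro components_without_adjacent_vertices) (auto simp: mem_odd_below)
  have "w v \<le> w u" if uS: "u \<in> ?S" and uv: "{u, v} \<in> edges G" for u v
  proof -
    obtain i where i: "u = 2 * i + 1" "i < k"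
      using uS unfolding odd_below_def by blast
    have "v = 2 * i \<or> v = 2 * i + 2"
      using uv i by (auto simp: edges_nat_path doubleton_eq_iff)
    then show ?thesis
      using dominates_left dominates_right i by auto
  qed
  then have "sum w B \<le> sum w A"
    if "A \<in> components (induced G ?S)" "B \<in> components (remove_verts G ?S)"
      "edges_between G A B \<noteq> {}" for A B
    using that unfolding C D by (auto simp: edges_between_def)
  moreover have "?S \<noteq> {}"
    using k_pos by (auto simp: odd_below_def)
  ultimately show ?thesis
    using S by (auto simp: weighted_safe_set_def verts_nat_path)
qed

text \<open>Suppose that the odd vertex \<open>2 * i + 1\<close> is missed but \<open>S\<close> resumes after the gap \<open>{x..z}\<close> around
  it. The component that follows the gap weighs at least as much as the gap. Together with the
  vertex \<open>2 * i\<close>, which lies either in \<open>S\<close> or in the gap, \<open>S\<close> therefore pays for the whole pair and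
  exceeds the budget.\<close>

lemma no_late_interval:
  assumes safe: "weighted_safe_set G w S"
    and cheap: "sum w S \<le> sum w (odd_below k)"
    and "i < k" "x \<le> 2 * i + 1" "2 * i + 1 \<le> z" "z < 2 * k"
    and gap: "{x..z} \<inter> S = {}" "\<And>u. Suc u = x \<Longrightarrow> u \<in> S" and next_in: "Suc z \<in> S"
    and early: "odd_below i \<subseteq> S"
    and even_vertex: "2 * i \<in> S \<or> x \<le> 2 * i"
  shows False
proof -
  have S: "S \<subseteq> {..<Suc (2 * k)}"
    using safe by (simp add: weighted_safe_set_def verts_nat_path)
  then have finS: "finite S"
    by (rule finite_subset) simp
  obtain y where y: "Suc z \<le> y" "{Suc z..y} \<subseteq> S" "Suc y \<notin> S"
    using interval_extends_maximally[OF finS next_in] by blast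
  have yk: "y < Suc (2 * k)"
    using y S by auto
  have le: "sum w {x..z} \<le> sum w {Suc z..y}"
    by (rule safe_set_interval_after_gap[OF safe])
      (use assms y yk in auto)
  have wpos: "0 \<le> w v" if "v \<in> S \<or> v \<le> z" for v
    by (rule less_imp_le, rule pos) (use that S \<open>z < 2 * k\<close> in auto)
  \<comment> \<open>The vertex \<open>2 * i\<close> is accounted for on exactly one side: in \<open>S\<close>, as \<open>E\<close>, or in the gap.\<close>
  define E where "E = (if 2 * i \<in> S then {2 * i} else {})"
  have disj: "(odd_below i \<union> E) \<inter> {Suc z..y} = {}" "odd_below i \<inter> E = {}"
    using assms by (auto simp: E_def mem_odd_below)
  have "sum w (odd_below i) + sum w E + sum w {Suc z..y} = sum w (odd_below i \<union> E \<union> {Suc z..y})"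
    using disj by (simp add: sum.union_disjoint E_def)
  also have "\<dots> \<le> sum w S"
    using early y finS wpos by (intro sum_mono2) (auto simp: E_def)
  finally have cost: "sum w (odd_below i) + sum w E + sum w {Suc z..y} \<le> sum w S" .
  have "w (2 * i) + w (2 * i + 1) \<le> sum w E + sum w {x..z}"
  proof (cases "2 * i \<in> S")
    case True
    have "sum w {2 * i + 1} \<le> sum w {x..z}"
      using assms wpos by (intro sum_mono2) auto
    then show ?thesis
      using True by (simp add: E_def)
  next
    case False
    have "sum w {2 * i, 2 * i + 1} \<le> sum w {x..z}"
      using assms wpos False by (intro sum_mono2) auto
    then show ?thesis
      using False by (simp add: E_def)
  qed
  then show False
    using cost le cheap budget_exceeded[OF \<open>i < k\<close>] by linarith
qed

lemma cheap_safe_set_alternates: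
  assumes safe: "weighted_safe_set G w S"
    and cheap: "sum w S \<le> sum w (odd_below k)"
    and "i < k"
  shows "2 * i \<notin> S \<and> 2 * i + 1 \<in> S"
  using \<open>i < k\<close>
proof (induction i rule: less_induct)
  case (less i)
  have S: "S \<subseteq> {..<Suc (2 * k)}" and nonempty: "S \<noteq> {}"
    using safe by (auto simp: weighted_safe_set_def verts_nat_path)
  then have finS: "finite S"
    using finite_subset by blast
  have wpos: "0 \<le> w v" if "v < Suc (2 * k)" for v
    by (rule less_imp_le, rule pos) (use that in simp)
  have early: "odd_below i \<subseteq> S"
    using less by (auto simp: odd_below_def)
  have prev: "2 * i - 1 \<in> S" "2 * i - 2 \<notin> S" if "0 < i"
  proof -
    obtain j where "i = Suc j"
      using \<open>0 < i\<close> gr0_implies_Suc by blast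
    then show "2 * i - 1 \<in> S" "2 * i - 2 \<notin> S"
      using less.IH[of j] less.prems by auto
  qed
  have odd_in: "2 * i + 1 \<in> S"
  proof (rule ccontr)
    assume out: "2 * i + 1 \<notin> S"
    obtain z where z: "2 * i + 1 \<le> z" "{2 * i + 1..z} \<subseteq> {..<Suc (2 * k)} - S"
        "Suc z \<notin> {..<Suc (2 * k)} - S"
      using interval_extends_maximally[of "{..<Suc (2 * k)} - S" "2 * i + 1"] out less.prems
      by auto
    then have zk: "z < Suc (2 * k)"
      by auto
    have zS: "Suc z \<in> S" if "z < 2 * k"
      using z that by auto
    show False
    proof (cases "2 * i \<in> S")
      case True
      \<comment> \<open>The component ending in \<open>2 * i\<close> is \<open>{2 * i - 1, 2 * i}\<close>, or \<open>{0}\<close> if \<open>i = 0\<close>; the gap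
        after it cannot end early and hence is the whole rest of the path, which is too heavy.\<close>
      have "z = 2 * k"
      proof (rule ccontr)
        assume "z \<noteq> 2 * k"
        with zk have "z < 2 * k" by simp
        then show False
          using no_late_interval[OF safe cheap less.prems, of "2 * i + 1" z] z zS early True
          by auto
      qed
      show False
      proof (cases i)
        case 0
        have le: "sum w {Suc 0..z} \<le> sum w {0..0}"
          by (rule safe_set_interval_before_gap[OF safe]) (use z zk zS True 0 in auto)
        have "sum w {1, 2} \<le> sum w {1..2 * k}"
          using k_pos wpos by (intro sum_mono2) auto
        then show False
          using le 0 \<open>z = 2 * k\<close> dominates_left[of 0] pos[of 2] k_pos by simp
      next
        case (Suc j)
        have before: "{2 * j + 1..2 * j + 2} = {2 * j + 1, 2 * j + 2}"
          by auto
        have "sum w {Suc (2 * j + 2)..z} \<le> sum w {2 * j + 1..2 * j + 2}"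
        proof (rule safe_set_interval_before_gap[OF safe])
          show "{2 * j + 1..2 * j + 2} \<subseteq> S"
            unfolding before using prev True Suc by simp
          show "u \<notin> S" if "Suc u = 2 * j + 1" for u
            using that prev Suc by auto
        qed (use z zk zS Suc in auto)
        then show False
          using before Suc \<open>z = 2 * k\<close> tail_exceeds[of j] less.prems
          by (simp add: numeral_3_eq_3)
      qed
    next
      \<comment> \<open>The gap starts at \<open>2 * i\<close> and contains the whole pair.\<close>
      case False
      show False
      proof (cases i)
        case 0
        have "z \<noteq> 2 * k"
        proof
          assume "z = 2 * k"
          have "v \<notin> S" for v
            using z(2) S False 0 \<open>z = 2 * k\<close> by (cases v) (auto simp: subset_iff)
          then show False
            using nonempty by blast
        qed
        then have "z < 2 * k"
          using zk by simp
        moreover have "{0..z} \<inter> S = {}"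
        proof -
          have "v \<notin> S" if "v \<le> z" for v
            using z(2) False 0 that by (cases v) (auto simp: subset_iff)
          then show ?thesis by auto
        qed
        ultimately show False
          using no_late_interval[OF safe cheap less.prems, of 0 z] z zS early 0
          by auto
      next
        case (Suc j)
        have gap: "{2 * i..z} \<inter> S = {}"
        proof -
          have "v \<notin> S" if "2 * i \<le> v" "v \<le> z" for v
            using z(2) False that by (cases "v = 2 * i") (auto simp: subset_iff)
          then show ?thesis by auto
        qed
        have "sum w {Suc (2 * j + 1)..z} \<le> sum w {2 * j + 1..2 * j + 1}"
          by (rule safe_set_interval_before_gap[OF safe])
            (use z zk zS prev gap Suc in auto)
        moreover have "sum w {2 * j + 2, 2 * j + 3} \<le> sum w {2 * j + 2..z}"
          using z zk Suc wpos by (intro sum_mono2) auto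
        ultimately show False
          using pair_exceeds_previous[of j] Suc less.prems by simp
      qed
    qed
  qed
  moreover have "2 * i \<notin> S"
  proof
    assume "2 * i \<in> S"
    then have "sum w (insert (2 * i) (insert (2 * i + 1) (odd_below i))) \<le> sum w S"
      using early odd_in finS S wpos by (intro sum_mono2) auto
    then show False
      using cheap budget_exceeded[OF less.prems] by (simp add: mem_odd_below)
  qed
  ultimately show ?case by simp
qed

lemma cheap_safe_set_unique:
  assumes safe: "weighted_safe_set G w S"
    and cheap: "sum w S \<le> sum w (odd_below k)"
  shows "S = odd_below k"
proof -
  have S: "S \<subseteq> {..<Suc (2 * k)}"
    using safe by (simp add: weighted_safe_set_def verts_nat_path)
  then have finS: "finite S"
    using finite_subset by blast
  have sub: "odd_below k \<subseteq> S"
    using cheap_safe_set_alternates[OF safe cheap] by (auto simp: odd_below_def)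
  show ?thesis
  proof (rule ccontr)
    assume "S \<noteq> odd_below k"
    then obtain v where "v \<in> S - odd_below k"
      using sub by blast
    then have "sum w (odd_below k) < sum w S"
      using sub finS S by (intro sum_strict_mono2[of S _ v]) (auto intro!: pos[THEN less_imp_le] pos)
    then show False
      using cheap by simp
  qed
qed

lemma min_weighted_safe_set_iff:
  "min_weighted_safe_set G w S \<longleftrightarrow> S = odd_below k"
proof -
  let ?sums = "{sum w S | S. weighted_safe_set G w S}"
  have "?sums \<subseteq> sum w ` Pow {..<Suc (2 * k)}"
    by (auto simp: weighted_safe_set_def verts_nat_path)
  then have "finite ?sums"
    using finite_subset by blast
  moreover have "sum w (odd_below k) \<in> ?sums"
    using odd_below_safe by blast
  moreover have "sum w (odd_below k) \<le> c" if "c \<in> ?sums" for c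
    using that cheap_safe_set_unique by fastforce
  ultimately have "weighted_safe_number G w = sum w (odd_below k)"
    unfolding weighted_safe_number_def by (intro Min_eqI) auto
  then show ?thesis
    using odd_below_safe cheap_safe_set_unique[of S] unfolding min_weighted_safe_set_def
    by (metis order_refl)
qed

lemma min_safe_components_eq: "min_safe_components G w = k"
proof -
  have "components (induced G (odd_below k)) = (\<lambda>v. {v}) ` odd_below k"
    by (intro components_without_adjacent_vertices) (auto simp: mem_odd_below)
  then have "num_components (induced G (odd_below k)) = k"
    by (simp add: num_components_def card_image card_odd_below)
  then show ?thesis
    by (simp add: min_safe_components_def min_weighted_safe_set_iff)
qed

end

section \<open>Existence of forcing weights\<close>

text \<open>Counted from the far end, the pairs are \<open>(2 * k, 3 * k + 1)\<close> for \<open>n = 0\<close> and twice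
  \<open>2 * k * 2 ^ n + 1\<close> for \<open>n \<ge> 1\<close>; the single last vertex weighs \<open>3 * k + 1\<close>. Pure doubling would turn the
  strict inequality \<open>pair_exceeds_previous\<close> into an equality, and the summand \<open>1\<close> gives the
  necessary margin. The margin in \<open>exceeds_later\<close> is then \<open>k + 1 - n\<close> for \<open>n \<ge> 1\<close>, so it uses up to \<open>k\<close>
  units that the lopsided end provides.
  The end cannot consist of an equal pair \<open>(c, c)\<close>: the last vertex would weigh at most \<open>c\<close>, so
  \<open>tail_exceeds\<close> would make the preceding odd vertex lighter than \<open>c\<close>, against \<open>exceeds_later\<close> and
  \<open>dominates_left\<close>.\<close>

definition doubling_weight :: "nat \<Rightarrow> nat \<Rightarrow> real" where
  "doubling_weight k v =
     (if 2 * k \<le> Suc v then 3 * real k + 1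
      else if 2 * k = v + 2 then 2 * real k
      else 2 * real k * 2 ^ (k - 1 - v div 2) + 1)"

text \<open>The inequalities compare neighbouring pairs and tails of the path, so it is convenient to index
  the pairs by their distance \<open>n\<close> from the last pair.\<close>

lemma doubling_weight_pair:
  assumes "n < k"
  shows "doubling_weight k (2 * (k - Suc n)) =
      (if n = 0 then 2 * real k else 2 * real k * 2 ^ n + 1)"
    and "doubling_weight k (Suc (2 * (k - Suc n))) =
      (if n = 0 then 3 * real k + 1 else 2 * real k * 2 ^ n + 1)"
proof -
  obtain i where "k = Suc (i + n)"
    using assms less_imp_Suc_add by (metis add.commute)
  then show "doubling_weight k (2 * (k - Suc n)) =
      (if n = 0 then 2 * real k else 2 * real k * 2 ^ n + 1)"
    and "doubling_weight k (Suc (2 * (k - Suc n))) =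
      (if n = 0 then 3 * real k + 1 else 2 * real k * 2 ^ n + 1)"
    by (auto simp: doubling_weight_def)
qed

lemma doubling_weight_last: "doubling_weight k (2 * k) = 3 * real k + 1"
  by (simp add: doubling_weight_def)

lemma sum_odd_doubling_weight:
  assumes "1 \<le> m" "m \<le> k"
  shows "(\<Sum>j\<in>{k - m..<k}. doubling_weight k (2 * j + 1)) = 2 * real k * 2 ^ m + real m - real k"
  using assms
proof (induction m rule: dec_induct)
  case base
  then have "{k - 1..<k} = {k - 1}" by auto
  then show ?case
    using doubling_weight_pair[of 0 k] doubling_weight_last[of k] base by simp
next
  case (step m)
  have "{k - Suc m..<k} = insert (k - Suc m) {k - m..<k}"
    using step by auto
  then show ?case
    using step doubling_weight_pair[of m k] by (simp add: algebra_simps)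
qed

lemma sum_tail_doubling_weight:
  assumes "1 \<le> m" "m \<le> k"
  shows "sum (doubling_weight k) {2 * (k - m)..2 * k} = 4 * real k * 2 ^ m + 2 * real m"
  using assms
proof (induction m rule: dec_induct)
  case base
  then have "{2 * (k - 1)..2 * k} = {2 * (k - 1), Suc (2 * (k - 1)), 2 * k}" by auto
  then show ?case
    using doubling_weight_pair[of 0 k] doubling_weight_last[of k] base by simp
next
  case (step m)
  have "{2 * (k - Suc m)..2 * k} =
      insert (2 * (k - Suc m)) (insert (Suc (2 * (k - Suc m))) {2 * (k - m)..2 * k})"
    using step by auto
  then show ?case
    using step doubling_weight_pair[of m k] by (simp add: algebra_simps)
qed

lemma forcing_weights_doubling_weight:
  assumes "0 < k"
  shows "forcing_weights k (doubling_weight k)"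
proof
  let ?w = "doubling_weight k"
  show "0 < k" by fact
  show "0 < ?w v" for v
    using assms by (auto simp: doubling_weight_def intro!: add_pos_pos)
  have by_distance: "\<exists>n<k. i = k - Suc n" if "i < k" for i
    using that by (intro exI[of _ "k - Suc i"]) auto
  have by_distance_Suc:
    "\<exists>n. Suc n < k \<and> i = k - Suc (Suc n) \<and> 2 * i + 2 = 2 * (k - Suc n) \<and>
         2 * i + 3 = Suc (2 * (k - Suc n))" if "Suc i < k" for i
    using that by (intro exI[of _ "k - Suc (Suc i)"]) auto
  have k_real: "1 \<le> real k"
    using assms by simp
  show "?w (2 * i) \<le> ?w (2 * i + 1)" if "i < k" for i
    using by_distance[OF that] by (auto simp: doubling_weight_pair)
  show "?w (2 * i + 2) \<le> ?w (2 * i + 1)" if "i < k" for i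
  proof (cases "Suc i < k")
    case True
    then obtain n where n: "Suc n < k" "i = k - Suc (Suc n)" "2 * i + 2 = 2 * (k - Suc n)"
      using by_distance_Suc[OF True] by blast
    then show ?thesis
      using doubling_weight_pair[of n k] doubling_weight_pair[of "Suc n" k]
      by (simp del: mult_Suc_right)
  next
    case False
    then have "k = Suc i"
      using that by simp
    then show ?thesis
      using doubling_weight_pair[of 0 k] doubling_weight_last[of k] by simp
  qed
  show "?w (2 * i + 1) < ?w (2 * i + 2) + ?w (2 * i + 3)" if less: "Suc i < k" for i
  proof -
    obtain n where n: "Suc n < k" "i = k - Suc (Suc n)" "2 * i + 2 = 2 * (k - Suc n)"
        "2 * i + 3 = Suc (2 * (k - Suc n))"
      using by_distance_Suc[OF less] by blast
    show ?thesis
      unfolding n(3,4)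
      using n(1,2) doubling_weight_pair[of n k] doubling_weight_pair[of "Suc n" k] by simp
  qed
  show "?w (2 * i + 1) + ?w (2 * i + 2) < sum ?w {2 * i + 3..2 * k}" if less: "Suc i < k" for i
  proof -
    obtain n where n: "Suc n < k" "i = k - Suc (Suc n)" "2 * i + 2 = 2 * (k - Suc n)"
        "2 * i + 3 = Suc (2 * (k - Suc n))"
      using by_distance_Suc[OF less] by blast
    have "sum ?w {2 * (k - Suc n)..2 * k} = ?w (2 * (k - Suc n)) + sum ?w {2 * i + 3..2 * k}"
      unfolding n(4) by (rule sum.atLeast_Suc_atMost) simp
    then show ?thesis
      using n k_real doubling_weight_pair[of n k] doubling_weight_pair[of "Suc n" k]
        sum_tail_doubling_weight[of "Suc n" k]
      by (simp split: if_splits)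
  qed
  show "(\<Sum>j\<in>{Suc i..<k}. ?w (2 * j + 1)) < ?w (2 * i)" if less: "i < k" for i
  proof -
    obtain n where n: "n < k" "i = k - Suc n"
      using by_distance[OF less] by blast
    then have "Suc i = k - n"
      by simp
    then show ?thesis
      using n k_real doubling_weight_pair[of n k] sum_odd_doubling_weight[of n k]
      by (cases "n = 0") simp_all
  qed
qed

theorem theorem1p7: "safe_infinite odd_paths"
proof -
  have unbounded: "enat k \<le> safe_f odd_paths" if "0 < k" for k
  proof -
    interpret forcing_weights k "doubling_weight k"
      using that by (rule forcing_weights_doubling_weight)
    have "is_path_graph G"
      unfolding is_path_graph_def nat_path_def
      by (intro exI[of _ "[0..<Suc (2 * k)]"]) (simp del: upt_Suc)
    then have "G \<in> odd_paths"
      by (simp add: odd_paths_def verts_nat_path)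
    moreover have "doubling_weight k \<in> weight_functions G"
      using pos by (auto simp: weight_functions_def verts_nat_path)
    ultimately have "enat (min_safe_components G (doubling_weight k)) \<le> safe_f odd_paths"
      unfolding safe_f_def by (meson SUP_upper2 order_refl)
    then show ?thesis
      by (simp only: min_safe_components_eq)
  qed
  show ?thesis
    unfolding safe_infinite_def safe_finite_def
  proof
    assume "safe_f odd_paths < \<infinity>"
    then obtain m where "safe_f odd_paths = enat m"
      by (metis enat_ord_simps(4) less_infinityE)
    then show False
      using unbounded[of "Suc m"] by simp
  qed
qed

end
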